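(* Let $M=[m_{i,j}]$ be a $k\times k$ upper triangular matrix with complex entries and with non-unique diagonal elements (i.e. the diagonal entries are not pairwise distinct), and let $1\le i\le j\le k$. Let $num(i,j)$ be the number of distinct values among the diagonal entries $m_{i,i},m_{i+1,i+1},\dots,m_{j,j}$, let $\{m_{i,j,r}\}_{r=1}^{num(i,j)}$ be the set of those distinct values, and let $mpy_{i,j}(r)$ be the multiplicity of the value $m_{i,j,r}$ in the list $m_{i,i},\dots,m_{j,j}$ (so $\sum_{r=1}^{num(i,j)} mpy_{i,j}(r)=j-i+1$). For each $r$, let $(i_1,i_1),(i_2,i_2),\dots,(i_{t},i_{t})$ with $t=mpy_{i,j}(r)$ and $i\le i_1<\dots<i_t\le j$ be the diagonal locations in rows $i$ through $j$ where the value $m_{i,j,r}$ appears. For $1\le s\le mpy_{i,j}(r)$ define $$c_{i,j,r,s}=\left[p_{i,j,i_1}x^{i_1(s-1)}+p_{i,j,i_2}x^{i_2(s-1)}+\cdots+p_{i,j,i_t}x^{i_t(s-1)}\right]_{x=0},$$ where $p_{i,j,i_1},\dots,p_{i,j,i_t}\in\mathbb{C}(x)$ are the power factors of the matrix obtained from $M$ by replacing each diagonal entry $m_{l,l}$ by $m_{l,l}+x^l$ ($1\le l\le k$), and $[\,\cdot\,]_{x=0}$ denotes the value at $x=0$ of the bracketed sum, regarded as a single rational function of $x$ in lowest terms. Then each bracketed sum has no pole at $x=0$ (so the numbers $c_{i,j,r,s}$, which do not depend on $n$, are well defined), and the $(i,j)$ entry ${}_nm_{i,j}$ of $M^n$ is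 $${}_nm_{i,j}=\sum_{r=1}^{num(i,j)}\ \sum_{s=1}^{mpy_{i,j}(r)} c_{i,j,r,s}\binom{n-1}{s-1}\,m_{i,j,r}^{\,n-s}$$ for all integers $n$ (negative, zero or positive) if $M$ is non-singular, and for all integers $n\ge 1$ if $M$ is singular, with $0^0$ taken as $1$.
   Context: Power factors: let $A=[a_{i,j}]$ be a $k\times k$ upper triangular matrix over a field (here $\mathbb{C}(x)$) whose diagonal entries are pairwise distinct. The power factors $p_{i,j,s}$ of $A$ ($1\le i\le j\le k$) are defined recursively on the index $j$ by: - $p_{j,j,j}=a_{j,j}$; - $p_{i,j,s}=\dfrac{\sum_{t=s}^{j-1}p_{i,t,s}\,a_{t,j}}{a_{s,s}-a_{j,j}}$ for $i\le s<j\le k$; - $p_{i,j,j}=a_{i,j}-\sum_{t=i}^{j-1}p_{i,j,t}$ for $i<j\le k$; - $p_{i,j,s}=0$ if $s<i$ or $s>j$. The matrix obtained from $M$ by replacing each $m_{l,l}$ by $m_{l,l}+x^l$ has pairwise distinct diagonal entries in $\mathbb{C}(x)$, so its power factors are defined. Conventions: $\binom{n-1}{s-1}=\frac{(n-1)(n-2)\cdots(n-s+1)}{(s-1)!}$ is the generalized binomial coefficient, defined for every integer $n$ (equal to $1$ when $s=1$). A term whose binomial coefficient is $0$ is taken to be $0$ (relevant when $m_{i,j,r}=0$ and $n<s$). *)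

theory Defs
  imports
    "HOL-Computational_Algebra.Computational_Algebra"
    "HOL-Computational_Algebra.Field_as_Ring"
    "Jordan_Normal_Form.Gauss_Jordan_Elimination"
begin

text \<open>
  Matrix rows and columns are numbered from \<open>0\<close>, as usual for the type \<open>mat\<close>: the mathematical
  entry in row \<open>i\<close> and column \<open>j\<close>, with \<open>1 \<le> i, j \<le> k\<close>, is \<open>A $$ (i - 1, j - 1)\<close>. The three
  indices of a power factor are shifted in the same way. Wherever an index also occurs as an
  exponent, the exponent is the unshifted number; hence the \<open>Suc l\<close> below.
\<close>

fun power_factor :: "'a::field mat \<Rightarrow> nat \<Rightarrow> nat \<Rightarrow> nat \<Rightarrow> 'a" where
  "power_factor A i j s =
    (if s < i \<or> s > j then 0
     else if s < j then
       (\<Sum>t = s..<j. power_factor A i t s * A $$ (t, j)) / (A $$ (s, s) - A $$ (j, j))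
     else if i = j then A $$ (j, j)
     else A $$ (i, j) - (\<Sum>t = i..<j. power_factor A i j t))"

text \<open>The defining equation is not guarded by a constructor pattern and would loop as a simp rule.\<close>

declare power_factor.simps [simp del]

definition ratfun_X :: "complex poly fract" where
  "ratfun_X = to_fract [:0, 1:]"

text \<open>
  \<open>quot_of_fract\<close> returns numerator and denominator in lowest terms, so a pole at \<open>z\<close> is a zero of
  the denominator.
\<close>

definition ratfun_has_pole :: "complex poly fract \<Rightarrow> complex \<Rightarrow> bool" where
  "ratfun_has_pole f z \<longleftrightarrow> poly (snd (quot_of_fract f)) z = 0"

definition ratfun_value :: "complex poly fract \<Rightarrow> complex \<Rightarrow> complex" where
  "ratfun_value f z = poly (fst (quot_of_fract f)) z / poly (snd (quot_of_fract f)) z"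

definition perturbed_mat :: "complex mat \<Rightarrow> complex poly fract mat" where
  "perturbed_mat M = mat (dim_row M) (dim_col M)
     (\<lambda>(i, j). to_fract [:M $$ (i, j):] + (if i = j then ratfun_X ^ Suc i else 0))"

definition diag_positions :: "complex mat \<Rightarrow> nat \<Rightarrow> nat \<Rightarrow> complex \<Rightarrow> nat set" where
  "diag_positions M i j v = {l \<in> {i..j}. M $$ (l, l) = v}"

definition diag_values :: "complex mat \<Rightarrow> nat \<Rightarrow> nat \<Rightarrow> complex set" where
  "diag_values M i j = (\<lambda>l. M $$ (l, l)) ` {i..j}"

definition diag_mult :: "complex mat \<Rightarrow> nat \<Rightarrow> nat \<Rightarrow> complex \<Rightarrow> nat" where
  "diag_mult M i j v = card (diag_positions M i j v)"

text \<open>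
  The distinct diagonal values are not enumerated; the value \<open>v\<close> itself takes the role of its
  number in an enumeration. The index \<open>s\<close> starts at \<open>1\<close>.
\<close>

definition coeff_ratfun ::
    "complex mat \<Rightarrow> nat \<Rightarrow> nat \<Rightarrow> complex \<Rightarrow> nat \<Rightarrow> complex poly fract" where
  "coeff_ratfun M i j v s =
    (\<Sum>l \<in> diag_positions M i j v.
       power_factor (perturbed_mat M) i j l * ratfun_X ^ (Suc l * (s - 1)))"

definition power_coeff :: "complex mat \<Rightarrow> nat \<Rightarrow> nat \<Rightarrow> complex \<Rightarrow> nat \<Rightarrow> complex" where
  "power_coeff M i j v s = ratfun_value (coeff_ratfun M i j v s) 0"

text \<open>For negative \<open>n\<close> this is meaningful only if \<open>A\<close> is invertible.\<close>

definition mat_power_int :: "'a::field mat \<Rightarrow> int \<Rightarrow> 'a mat" where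
  "mat_power_int A n =
    (if n \<ge> 0 then A ^\<^sub>m nat n else the (mat_inverse A) ^\<^sub>m nat (- n))"

end

theory Submission
  imports Defs "Jordan_Normal_Form.Determinant"
begin

text \<open>
  Write \<open>A\<close> for the perturbed matrix and \<open>d\<^sub>l = m\<^sub>l\<^sub>l + x\<^sup>l\<close> for its diagonal entries,
  with \<open>l\<close> counted from \<open>1\<close>. For fixed \<open>i\<close> and \<open>s\<close>, the power factors \<open>p\<^sub>i\<^sub>t\<^sub>s\<close>
  form a left eigenvector of \<open>A\<close> for the eigenvalue \<open>d\<^sub>s\<close>, and summed over \<open>s\<close> these
  vectors give row \<open>i\<close> of \<open>A\<close> (\<open>power_factor_eigen\<close>, \<open>sum_power_factor\<close>). A single power factor
  usually has a pole at \<open>x = 0\<close>, because the differences \<open>d\<^sub>s - d\<^sub>t\<close> of its denominators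
  vanish there whenever \<open>m\<^sub>s\<^sub>s = m\<^sub>t\<^sub>t\<close>.

  The poles cancel in the sums of the theorem for the following reason. The sum of
  \<open>p\<^sub>i\<^sub>j\<^sub>l f(d\<^sub>l)\<close> over all \<open>l\<close> is the \<open>(i, j)\<close> entry of \<open>A f(A)\<close>, hence regular
  at \<open>0\<close>, for each polynomial \<open>f\<close> with regular coefficients. Such an \<open>f\<close> can be chosen to be
  \<open>1\<close> at every \<open>d\<^sub>l\<close> with \<open>m\<^sub>l\<^sub>l = v\<close> and \<open>0\<close> at the other \<open>d\<^sub>l\<close>, as the denominators
  of this interpolation are differences of diagonal entries that stay apart at \<open>x = 0\<close>
  (\<open>selector_eq\<close>, \<open>multiplier_selector\<close>). Multiplied by \<open>(t - v)\<^sup>q\<close> it turns the sum into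
  \<open>coeff_ratfun\<close> for \<open>s = q + 1\<close>, which is therefore regular for every \<open>q\<close>
  (\<open>coeff_ratfun_regular\<close>). Its value at \<open>0\<close> is zero once \<open>q\<close> reaches the multiplicity
  \<open>\<mu>\<close> of \<open>v\<close> among the diagonal entries from \<open>i\<close> to \<open>j\<close>: replacing
  \<open>(t - v)\<^sup>\<mu>\<close> by the product of the \<open>t - d\<^sub>l\<close> at these positions
  does not change the value, and that product vanishes at all these \<open>d\<^sub>l\<close>
  (\<open>power_coeff_vanishes\<close>).

  Evaluated at \<open>0\<close>, the eigenvector equation becomes a recursion between the coefficients for
  \<open>q\<close> and \<open>q + 1\<close> (\<open>power_coeff_recursion\<close>). With Pascal's rule it says that the matrix
  \<open>E(n)\<close> of claimed values satisfies \<open>E(n + 1) = E(n) M\<close>, for every integer \<open>n\<close> if no diagonal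
  entry is zero and for \<open>n \<ge> 1\<close> otherwise (\<open>expansion_step\<close>). Since \<open>E(1) = M\<close>, this
  determines \<open>E(n) = M\<^sup>n\<close>, going upwards always and downwards when \<open>M\<close> is invertible.
\<close>

section \<open>Power factors and eigenvectors\<close>

lemma power_factor_outside:
  "s < i \<or> j < s \<Longrightarrow> power_factor A i j s = 0"
  by (subst power_factor.simps) auto

text \<open>
  For \<open>i \<le> s < j\<close> the recursion defining \<open>power_factor A i j s\<close> is this equation solved for its last
  summand; for \<open>i \<le> s = j\<close> only one summand is left, and otherwise both sides vanish.
\<close>

lemma power_factor_eigen:
  fixes A :: "'a::field mat"
  assumes A: "A \<in> carrier_mat k k" "upper_triangular A"
    and distinct: "\<And>s t. s < t \<Longrightarrow> t < k \<Longrightarrow> A $$ (s, s) \<noteq> A $$ (t, t)"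
    and j: "j < k"
  shows "(\<Sum>t<k. power_factor A i t s * A $$ (t, j)) = A $$ (s, s) * power_factor A i j s"
proof -
  have "(\<Sum>t<k. power_factor A i t s * A $$ (t, j))
      = (\<Sum>t = s..j. power_factor A i t s * A $$ (t, j))"
    using A j upper_triangularD[OF A(2)]
    by (intro sum.mono_neutral_right) (auto simp: power_factor_outside not_le)
  also have "\<dots> = A $$ (s, s) * power_factor A i j s"
  proof -
    consider "s < i \<or> j < s" | "i \<le> s" "s = j" | "i \<le> s" "s < j" by linarith
    then show ?thesis
    proof cases
      case 1
      then show ?thesis by (auto simp: power_factor_outside)
    next
      case 2
      then show ?thesis by simp
    next
      case 3
      let ?S = "\<Sum>t = s..<j. power_factor A i t s * A $$ (t, j)"
      have "power_factor A i j s = ?S / (A $$ (s, s) - A $$ (j, j))"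
        using 3 by (subst power_factor.simps) auto
      then have "?S = (A $$ (s, s) - A $$ (j, j)) * power_factor A i j s"
        using distinct[OF 3(2) j] by simp
      moreover have "(\<Sum>t = s..j. power_factor A i t s * A $$ (t, j))
          = ?S + power_factor A i j s * A $$ (j, j)"
        using 3 by (simp add: sum.last_plus add.commute)
      ultimately show ?thesis by (simp add: algebra_simps)
    qed
  qed
  finally show ?thesis .
qed

text \<open>The clause for \<open>power_factor A i j j\<close> is chosen exactly so that this sum comes out.\<close>

lemma sum_power_factor:
  fixes A :: "'a::field mat"
  assumes A: "A \<in> carrier_mat k k" "upper_triangular A" and ij: "i < k" "j < k"
  shows "(\<Sum>s<k. power_factor A i j s) = A $$ (i, j)"
proof -
  have "(\<Sum>s<k. power_factor A i j s) = (\<Sum>s = i..j. power_factor A i j s)"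
    using ij by (intro sum.mono_neutral_right) (auto simp: power_factor_outside not_le)
  also have "\<dots> = A $$ (i, j)"
  proof -
    consider "j < i" | "i = j" | "i < j" by linarith
    then show ?thesis
    proof cases
      case 1
      then show ?thesis using A ij by (auto dest: upper_triangularD)
    next
      case 2
      then show ?thesis by (subst power_factor.simps) simp
    next
      case 3
      have "power_factor A i j j = A $$ (i, j) - (\<Sum>t = i..<j. power_factor A i j t)"
        using 3 by (subst power_factor.simps) simp
      then show ?thesis using 3 by (simp add: sum.last_plus)
    qed
  qed
  finally show ?thesis .
qed

section \<open>Rational functions without a pole at a point\<close>

text \<open>
  Poles and values are defined through the reduced fraction; any other representation with a
  denominator that is nonzero at \<open>z\<close> yields the same, because the reduced denominator divides it.
  This makes the functions without a pole at \<open>z\<close> a ring on which evaluation is a homomorphism.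
\<close>

lemma ratfun_fraction:
  assumes eq: "f * to_fract b = to_fract a" and b: "poly b z \<noteq> 0"
  shows "\<not> ratfun_has_pole f z" "ratfun_value f z = poly a z / poly b z"
proof -
  obtain a' b' where q: "quot_of_fract f = (a', b')" by fastforce
  have b'0: "b' \<noteq> 0" using snd_quot_of_fract_nonzero[of f] q by simp
  have f: "f = to_fract a' / to_fract b'"
    using Fract_quot_of_fract[of f] q by (simp add: Fract_conv_to_fract)
  have "to_fract (a' * b) = to_fract (a * b')"
    using eq b'0 unfolding f by (simp add: field_simps)
  then have cross: "a' * b = a * b'" by (simp only: to_fract_eq_iff)
  have "coprime b' a'" using coprime_quot_of_fract[of f] q by (simp add: coprime_commute)
  moreover have "b' dvd a' * b" using cross by simp
  ultimately have "b' dvd b" using coprime_dvd_mult_right_iff by blast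
  then have b': "poly b' z \<noteq> 0" using b by auto
  then show "\<not> ratfun_has_pole f z" by (simp add: ratfun_has_pole_def q)
  have "poly a' z * poly b z = poly a z * poly b' z"
    using cross by (metis poly_mult)
  then show "ratfun_value f z = poly a z / poly b z"
    using b b' by (simp add: ratfun_value_def q field_simps)
qed

lemma ratfun_no_poleE:
  assumes "\<not> ratfun_has_pole f z"
  obtains a b where "f * to_fract b = to_fract a" "poly b z \<noteq> 0"
    "ratfun_value f z = poly a z / poly b z"
proof -
  obtain a b where q: "quot_of_fract f = (a, b)" by fastforce
  have "b \<noteq> 0" using snd_quot_of_fract_nonzero[of f] q by simp
  moreover have "f = to_fract a / to_fract b"
    using Fract_quot_of_fract[of f] q by (simp add: Fract_conv_to_fract)
  ultimately have "f * to_fract b = to_fract a" by simp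
  then show ?thesis
    using that assms by (simp add: ratfun_has_pole_def ratfun_value_def q)
qed

lemma ratfun_of_poly [simp]:
  "\<not> ratfun_has_pole (to_fract a) z" "ratfun_value (to_fract a) z = poly a z"
  using ratfun_fraction[of "to_fract a" 1 a z] by auto

lemma ratfun_0_1 [simp]:
  "\<not> ratfun_has_pole 0 z" "ratfun_value 0 z = 0" "\<not> ratfun_has_pole 1 z" "ratfun_value 1 z = 1"
  using ratfun_of_poly[of 0] ratfun_of_poly[of 1] by auto

lemma ratfun_add [simp]:
  assumes "\<not> ratfun_has_pole f z" "\<not> ratfun_has_pole g z"
  shows "\<not> ratfun_has_pole (f + g) z" "ratfun_value (f + g) z = ratfun_value f z + ratfun_value g z"
proof -
  obtain a b where f: "f * to_fract b = to_fract a" "poly b z \<noteq> 0"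
    "ratfun_value f z = poly a z / poly b z" using ratfun_no_poleE[OF assms(1)] .
  obtain c d where g: "g * to_fract d = to_fract c" "poly d z \<noteq> 0"
    "ratfun_value g z = poly c z / poly d z" using ratfun_no_poleE[OF assms(2)] .
  have "(f + g) * to_fract (b * d) = (f * to_fract b) * to_fract d + (g * to_fract d) * to_fract b"
    by (simp add: algebra_simps)
  also have "\<dots> = to_fract (a * d + c * b)" by (simp add: f(1) g(1))
  finally have eq: "(f + g) * to_fract (b * d) = to_fract (a * d + c * b)" .
  have nz: "poly (b * d) z \<noteq> 0" using f g by simp
  show "\<not> ratfun_has_pole (f + g) z" by (rule ratfun_fraction[OF eq nz])
  show "ratfun_value (f + g) z = ratfun_value f z + ratfun_value g z"
    using f g by (simp add: ratfun_fraction(2)[OF eq nz] field_simps)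
qed

lemma ratfun_mult [simp]:
  assumes "\<not> ratfun_has_pole f z" "\<not> ratfun_has_pole g z"
  shows "\<not> ratfun_has_pole (f * g) z" "ratfun_value (f * g) z = ratfun_value f z * ratfun_value g z"
proof -
  obtain a b where f: "f * to_fract b = to_fract a" "poly b z \<noteq> 0"
    "ratfun_value f z = poly a z / poly b z" using ratfun_no_poleE[OF assms(1)] .
  obtain c d where g: "g * to_fract d = to_fract c" "poly d z \<noteq> 0"
    "ratfun_value g z = poly c z / poly d z" using ratfun_no_poleE[OF assms(2)] .
  have "(f * g) * to_fract (b * d) = (f * to_fract b) * (g * to_fract d)"
    by (simp add: algebra_simps)
  also have "\<dots> = to_fract (a * c)" by (simp add: f(1) g(1))
  finally have eq: "(f * g) * to_fract (b * d) = to_fract (a * c)" .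
  have nz: "poly (b * d) z \<noteq> 0" using f g by simp
  show "\<not> ratfun_has_pole (f * g) z" by (rule ratfun_fraction[OF eq nz])
  show "ratfun_value (f * g) z = ratfun_value f z * ratfun_value g z"
    using f g by (simp add: ratfun_fraction(2)[OF eq nz])
qed

lemma ratfun_inverse:
  assumes "\<not> ratfun_has_pole f z" "ratfun_value f z \<noteq> 0"
  shows "\<not> ratfun_has_pole (inverse f) z"
proof -
  obtain a b where f: "f * to_fract b = to_fract a" "poly b z \<noteq> 0"
    "ratfun_value f z = poly a z / poly b z" using ratfun_no_poleE[OF assms(1)] .
  have a: "poly a z \<noteq> 0" using assms f by auto
  have "f \<noteq> 0" using assms by auto
  then have "inverse f * to_fract a = to_fract b" by (simp add: f(1)[symmetric])
  then show ?thesis using a by (rule ratfun_fraction)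
qed

lemma ratfun_diff [simp]:
  assumes "\<not> ratfun_has_pole f z" "\<not> ratfun_has_pole g z"
  shows "\<not> ratfun_has_pole (f - g) z" "ratfun_value (f - g) z = ratfun_value f z - ratfun_value g z"
proof -
  have eq: "f - g = f + to_fract (- 1) * g" by simp
  show "\<not> ratfun_has_pole (f - g) z" unfolding eq using assms by (intro ratfun_add ratfun_mult ratfun_of_poly)
  show "ratfun_value (f - g) z = ratfun_value f z - ratfun_value g z"
    unfolding eq using assms by (subst ratfun_add ratfun_mult ratfun_of_poly; simp del: to_fract_uminus)+
qed

lemma ratfun_sum:
  assumes "\<And>l. l \<in> S \<Longrightarrow> \<not> ratfun_has_pole (f l) z"
  shows "\<not> ratfun_has_pole (sum f S) z \<and> ratfun_value (sum f S) z = (\<Sum>l\<in>S. ratfun_value (f l) z)"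
  using assms by (induction S rule: infinite_finite_induct) auto

lemma ratfun_X_power [simp]:
  "\<not> ratfun_has_pole (ratfun_X ^ n) z" "ratfun_value (ratfun_X ^ n) z = z ^ n"
  by (induction n) (auto simp: ratfun_X_def)

abbreviation ratfun_const :: "complex \<Rightarrow> complex poly fract" where
  "ratfun_const c \<equiv> to_fract [:c:]"

section \<open>Regular sums over a block of equal diagonal entries\<close>

locale triangular_matrix =
  fixes M :: "complex mat" and k :: nat
  assumes M: "M \<in> carrier_mat k k" and triangular: "upper_triangular M"
begin

abbreviation A :: "complex poly fract mat" where "A \<equiv> perturbed_mat M"

abbreviation p :: "nat \<Rightarrow> nat \<Rightarrow> nat \<Rightarrow> complex poly fract" where "p \<equiv> power_factor A"

abbreviation d :: "nat \<Rightarrow> complex poly fract" where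
  "d l \<equiv> ratfun_const (M $$ (l, l)) + ratfun_X ^ Suc l"

abbreviation regular :: "complex poly fract \<Rightarrow> bool" where
  "regular f \<equiv> \<not> ratfun_has_pole f 0"

lemma perturbed_carrier: "A \<in> carrier_mat k k"
  using M by (auto simp: perturbed_mat_def)

lemma perturbed_entry:
  "i < k \<Longrightarrow> j < k \<Longrightarrow>
    A $$ (i, j) = ratfun_const (M $$ (i, j)) + (if i = j then ratfun_X ^ Suc i else 0)"
  using M by (auto simp: perturbed_mat_def)

lemma perturbed_entry_regular:
  assumes "i < k" "j < k"
  shows "regular (A $$ (i, j))" "ratfun_value (A $$ (i, j)) 0 = M $$ (i, j)"
  using assms by (auto simp: perturbed_entry simp del: power_Suc)

lemma perturbed_triangular: "upper_triangular A"
  using perturbed_carrier M triangular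
  by (intro upper_triangularI) (auto simp: perturbed_entry dest: upper_triangularD)

text \<open>Evaluation at \<open>2\<close> separates the powers of the indeterminate.\<close>

lemma ratfun_X_power_eq_iff: "ratfun_X ^ m = ratfun_X ^ n \<longleftrightarrow> m = n"
proof
  assume "ratfun_X ^ m = ratfun_X ^ n"
  then have "(2::complex) ^ m = 2 ^ n" by (metis ratfun_X_power(2))
  then have "(2::nat) ^ m = 2 ^ n"
    by (metis (mono_tags) of_nat_eq_iff of_nat_numeral of_nat_power)
  then show "m = n" by simp
qed simp

lemma perturbed_diagonal_distinct:
  assumes "s \<noteq> t"
  shows "d s \<noteq> d t"
proof
  assume eq: "d s = d t"
  then have "ratfun_value (d s) 0 = ratfun_value (d t) 0" by simp
  then have "M $$ (s, s) = M $$ (t, t)" by (simp del: power_Suc)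
  with eq have "ratfun_X ^ Suc s = ratfun_X ^ Suc t" by simp
  then show False using assms by (simp only: ratfun_X_power_eq_iff)
qed

lemma p_eigen: "j < k \<Longrightarrow> s < k \<Longrightarrow> (\<Sum>t<k. p i t s * A $$ (t, j)) = d s * p i j s"
  using power_factor_eigen[OF perturbed_carrier perturbed_triangular, of j i s]
    perturbed_diagonal_distinct by (simp add: perturbed_entry)

lemma p_sum: "i < k \<Longrightarrow> j < k \<Longrightarrow> (\<Sum>s<k. p i j s) = A $$ (i, j)"
  by (rule sum_power_factor[OF perturbed_carrier perturbed_triangular])

text \<open>
  A function \<open>h\<close> on the diagonal indices stands for the values \<open>f(d\<^sub>l)\<close> of a polynomial \<open>f\<close>.
  It is admissible if the poles of the power factors cancel in all sums weighted by \<open>h\<close>. The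
  functions that preserve admissibility visibly form an algebra over the regular rational
  functions; this replaces a calculus of polynomials in \<open>A\<close>.
\<close>

definition admissible :: "(nat \<Rightarrow> complex poly fract) \<Rightarrow> bool" where
  "admissible h \<longleftrightarrow> (\<forall>i<k. \<forall>j<k. regular (\<Sum>l<k. p i j l * h l))"

definition multiplier :: "(nat \<Rightarrow> complex poly fract) \<Rightarrow> bool" where
  "multiplier g \<longleftrightarrow> (\<forall>h. admissible h \<longrightarrow> admissible (\<lambda>l. g l * h l))"

lemma admissible_one: "admissible (\<lambda>_. 1)"
  by (auto simp: admissible_def p_sum perturbed_entry_regular)

lemma multiplierD: "multiplier g \<Longrightarrow> admissible h \<Longrightarrow> admissible (\<lambda>l. g l * h l)"
  by (simp add: multiplier_def)

lemma multiplier_const: "regular r \<Longrightarrow> multiplier (\<lambda>_. r)"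
  by (auto simp: multiplier_def admissible_def mult.left_commute sum_distrib_left[symmetric])

lemma multiplier_diff: "multiplier f \<Longrightarrow> multiplier g \<Longrightarrow> multiplier (\<lambda>l. f l - g l)"
  by (auto simp: multiplier_def admissible_def algebra_simps sum_subtractf)

lemma multiplier_mult: "multiplier f \<Longrightarrow> multiplier g \<Longrightarrow> multiplier (\<lambda>l. f l * g l)"
  by (auto simp: multiplier_def mult.assoc)

lemma multiplier_prod: "(\<And>m. m \<in> S \<Longrightarrow> multiplier (f m)) \<Longrightarrow> multiplier (\<lambda>l. \<Prod>m\<in>S. f m l)"
  by (induction S rule: infinite_finite_induct) (auto intro: multiplier_mult multiplier_const)

lemma multiplier_power: "multiplier f \<Longrightarrow> multiplier (\<lambda>l. f l ^ n)"
  by (induction n) (auto intro: multiplier_mult multiplier_const)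

text \<open>
  This is where the eigenvector equation enters: inserting a factor \<open>d\<^sub>l\<close> amounts to multiplying
  the matrix of weighted sums by \<open>A\<close>, whose entries are regular.
\<close>

lemma multiplier_diagonal: "multiplier d"
  unfolding multiplier_def admissible_def
proof (intro allI impI)
  fix h i j
  assume h: "\<forall>i<k. \<forall>j<k. regular (\<Sum>l<k. p i j l * h l)" and ij: "i < k" "j < k"
  have "(\<Sum>l<k. p i j l * (d l * h l)) = (\<Sum>l<k. (\<Sum>t<k. p i t l * A $$ (t, j)) * h l)"
    using p_eigen[OF ij(2)] by (intro sum.cong) (auto simp: mult_ac)
  also have "\<dots> = (\<Sum>l<k. \<Sum>t<k. p i t l * h l * A $$ (t, j))"
    by (simp add: sum_distrib_left sum_distrib_right mult_ac)
  also have "\<dots> = (\<Sum>t<k. (\<Sum>l<k. p i t l * h l) * A $$ (t, j))"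
    by (subst sum.swap) (simp only: sum_distrib_right)
  finally have eq: "(\<Sum>l<k. p i j l * (d l * h l))
      = (\<Sum>t<k. (\<Sum>l<k. p i t l * h l) * A $$ (t, j))" .
  have "regular (\<Sum>t<k. (\<Sum>l<k. p i t l * h l) * A $$ (t, j))"
  proof (rule ratfun_sum[THEN conjunct1])
    fix t assume "t \<in> {..<k}"
    then have "regular (\<Sum>l<k. p i t l * h l)" "regular (A $$ (t, j))"
      using h ij by (auto simp: perturbed_entry_regular)
    then show "regular ((\<Sum>l<k. p i t l * h l) * A $$ (t, j))" by (rule ratfun_mult)
  qed
  then show "regular (\<Sum>l<k. p i j l * (d l * h l))" unfolding eq .
qed

definition block :: "complex \<Rightarrow> nat set" where
  "block v = {l. l < k \<and> M $$ (l, l) = v}"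

text \<open>
  At \<open>d\<^sub>m\<close> for \<open>m\<close> outside the block the inner product is \<open>1\<close>, and at \<open>d\<^sub>t\<close> for \<open>t\<close> inside
  the block it is \<open>0\<close>. So the selector interpolates the indicator function of the block by a
  polynomial in \<open>d\<^sub>t\<close>, without using differences of entries of the same block as denominators.
\<close>

definition selector :: "complex \<Rightarrow> nat \<Rightarrow> complex poly fract" where
  "selector v t = (\<Prod>m \<in> {..<k} - block v. 1 - (\<Prod>l \<in> block v. (d t - d l) * inverse (d m - d l)))"

lemma finite_block [simp]: "finite (block v)"
  by (simp add: block_def)

text \<open>
  The denominators \<open>d\<^sub>m - d\<^sub>l\<close> have the nonzero value \<open>m\<^sub>m\<^sub>m - m\<^sub>l\<^sub>l\<close> at \<open>0\<close>, so the
  coefficients of the interpolating polynomial are regular.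
\<close>

lemma multiplier_selector: "multiplier (selector v)"
  unfolding selector_def
proof (intro multiplier_prod multiplier_diff multiplier_mult multiplier_const multiplier_diagonal)
  fix m l assume "m \<in> {..<k} - block v" "l \<in> block v"
  then have "M $$ (m, m) \<noteq> M $$ (l, l)" by (auto simp: block_def)
  then show "regular (inverse (d m - d l))"
    by (intro ratfun_inverse) (auto simp del: power_Suc)
qed (auto simp del: power_Suc)

lemma selector_eq:
  assumes "t < k"
  shows "selector v t = (if t \<in> block v then 1 else 0)"
proof (cases "t \<in> block v")
  case True
  then have zero: "(\<Prod>l \<in> block v. (d t - d l) * inverse (d m - d l)) = 0" for m
    by (intro prod_zero) (auto intro!: bexI[of _ t])
  show ?thesis unfolding selector_def zero using True by simp
next
  case False
  have "(\<Prod>l \<in> block v. (d t - d l) * inverse (d t - d l)) = 1"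
  proof (intro prod.neutral ballI)
    fix l assume "l \<in> block v"
    then have "d t \<noteq> d l" using False by (intro perturbed_diagonal_distinct) auto
    then show "(d t - d l) * inverse (d t - d l) = 1" by simp
  qed
  then have "1 - (\<Prod>l \<in> block v. (d t - d l) * inverse (d t - d l)) = 0" by simp
  then show ?thesis
    using False assms unfolding selector_def
    by (auto intro!: prod_zero bexI[of _ t] simp del: power_Suc)
qed

lemma coeff_ratfun_eq_block_sum:
  assumes "j < k"
  shows "coeff_ratfun M i j v (Suc q) = (\<Sum>l \<in> block v. p i j l * ratfun_X ^ (Suc l * q))"
proof -
  have "p i j l = 0" if "l \<in> block v - diag_positions M i j v" for l
    using that by (intro power_factor_outside) (auto simp: block_def diag_positions_def)
  then show ?thesis
    unfolding coeff_ratfun_def using assms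
    by (intro sum.mono_neutral_cong_left) (auto simp: block_def diag_positions_def)
qed

text \<open>On the block of \<open>v\<close> the power of the indeterminate is a power of \<open>d\<^sub>l - v\<close>.\<close>

lemma coeff_ratfun_eq_selector_sum:
  assumes "j < k"
  shows "coeff_ratfun M i j v (Suc q)
    = (\<Sum>l<k. p i j l * (selector v l * (d l - ratfun_const v) ^ q))"
  unfolding coeff_ratfun_eq_block_sum[OF assms]
  by (intro sum.mono_neutral_cong_left)
    (auto simp: block_def selector_eq power_mult simp del: power_Suc mult_Suc)

lemma admissible_selector_power: "admissible (\<lambda>l. selector v l * (d l - ratfun_const v) ^ q)"
proof -
  have "multiplier (\<lambda>l. (d l - ratfun_const v) ^ q)"
    by (intro multiplier_power multiplier_diff multiplier_diagonal multiplier_const) simp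
  from multiplierD[OF multiplier_selector multiplierD[OF this admissible_one]]
  show ?thesis by (simp del: power_Suc)
qed

lemma coeff_ratfun_regular:
  assumes "i < k" "j < k"
  shows "regular (coeff_ratfun M i j v (Suc q))"
  using admissible_selector_power assms
  by (simp add: coeff_ratfun_eq_selector_sum admissible_def del: power_Suc)

text \<open>
  The products \<open>\<Prod>(g - x\<^sup>m)\<close> and \<open>g\<^bsup>|P|\<^esup>\<close> are congruent modulo \<open>x\<close>. Splitting off one
  factor leaves an error \<open>x\<^sup>m\<close> times a regular sum, whose value at \<open>0\<close> is zero.
\<close>

lemma node_product_value:
  assumes "finite P" "admissible h" "multiplier g" "i < k" "j < k"
  shows "ratfun_value (\<Sum>l<k. p i j l * ((\<Prod>m\<in>P. g l - ratfun_X ^ Suc m) * h l)) 0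
    = ratfun_value (\<Sum>l<k. p i j l * (g l ^ card P * h l)) 0"
  using assms(1,2)
proof (induction P arbitrary: h rule: finite_induct)
  case empty
  then show ?case by simp
next
  case (insert m P)
  let ?N = "\<lambda>l. \<Prod>m\<in>P. g l - ratfun_X ^ Suc m"
  have adm: "admissible (\<lambda>l. g l * h l)" by (rule multiplierD[OF assms(3) insert.prems])
  have N: "multiplier ?N"
    by (intro multiplier_prod multiplier_diff assms(3) multiplier_const) (simp del: power_Suc)
  have r1: "regular (\<Sum>l<k. p i j l * (?N l * (g l * h l)))"
    using multiplierD[OF N adm] assms by (simp add: admissible_def del: power_Suc)
  have r2: "regular (\<Sum>l<k. p i j l * (?N l * h l))"
    using multiplierD[OF N insert.prems] assms by (simp add: admissible_def del: power_Suc)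
  have "(\<Sum>l<k. p i j l * ((\<Prod>m\<in>insert m P. g l - ratfun_X ^ Suc m) * h l))
      = (\<Sum>l<k. p i j l * (?N l * (g l * h l))) - ratfun_X ^ Suc m * (\<Sum>l<k. p i j l * (?N l * h l))"
    using insert.hyps by (simp add: sum_distrib_left sum_subtractf[symmetric] algebra_simps del: power_Suc)
  also have "ratfun_value \<dots> 0 = ratfun_value (\<Sum>l<k. p i j l * (?N l * (g l * h l))) 0"
    using r1 r2 by (simp del: power_Suc)
  also have "\<dots> = ratfun_value (\<Sum>l<k. p i j l * (g l ^ card P * (g l * h l))) 0"
    by (rule insert.IH[OF adm])
  finally show ?case using insert.hyps by (simp add: mult_ac)
qed

text \<open>
  The first \<open>diag_mult M i j v\<close> factors \<open>d\<^sub>l - v\<close> may be replaced by the product of the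
  \<open>(d\<^sub>l - v) - x\<^sup>m\<close> over the positions \<open>m\<close> of \<open>v\<close> between \<open>i\<close> and \<open>j\<close>. Afterwards every term
  is zero: by that product at these positions, by the selector at other diagonal values, and by the
  power factor outside the range from \<open>i\<close> to \<open>j\<close>.
\<close>

lemma power_coeff_vanishes:
  assumes "i < k" "j < k" "diag_mult M i j v \<le> q"
  shows "power_coeff M i j v (Suc q) = 0"
proof -
  let ?P = "diag_positions M i j v" and ?w = "\<lambda>l. d l - ratfun_const v"
  let ?r = "q - card ?P" and ?N = "\<lambda>l. \<Prod>m\<in>?P. (d l - ratfun_const v) - ratfun_X ^ Suc m"
  have fin: "finite ?P" by (simp add: diag_positions_def)
  have q: "q = card ?P + ?r" using assms(3) by (simp add: diag_mult_def)
  have w: "multiplier ?w" by (intro multiplier_diff multiplier_diagonal multiplier_const) simp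
  have "power_coeff M i j v (Suc q)
      = ratfun_value (\<Sum>l<k. p i j l * (?w l ^ card ?P * (selector v l * ?w l ^ ?r))) 0"
    unfolding power_coeff_def coeff_ratfun_eq_selector_sum[OF assms(2)]
    by (subst q) (simp add: power_add mult_ac del: power_Suc)
  also have "\<dots> = ratfun_value (\<Sum>l<k. p i j l * (?N l * (selector v l * ?w l ^ ?r))) 0"
    by (rule node_product_value[OF fin admissible_selector_power w assms(1,2), symmetric])
  also have "(\<Sum>l<k. p i j l * (?N l * (selector v l * ?w l ^ ?r))) = 0"
  proof (intro sum.neutral ballI)
    fix l assume l: "l \<in> {..<k}"
    consider "l \<in> ?P" | "l < i \<or> j < l" | "l \<notin> block v"
      using l by (force simp: diag_positions_def block_def)
    then show "p i j l * (?N l * (selector v l * ?w l ^ ?r)) = 0"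
    proof cases
      case 1
      then have "?N l = 0"
        by (intro prod_zero fin bexI[of _ l]) (auto simp: diag_positions_def)
      then show ?thesis by (simp del: power_Suc)
    next
      case 2
      then show ?thesis by (simp add: power_factor_outside del: power_Suc)
    next
      case 3
      then show ?thesis using l by (simp add: selector_eq del: power_Suc)
    qed
  qed
  finally show ?thesis by simp
qed

section \<open>The recursion of the coefficients\<close>

text \<open>
  The eigenvector equation multiplied by \<open>x\<^sup>l\<^sup>q\<close> and summed over the block of \<open>v\<close>, where
  \<open>d\<^sub>l = v + x\<^sup>l\<close>, with \<open>l\<close> counted from \<open>1\<close>. Both sides are then evaluated at \<open>0\<close>.
\<close>

lemma power_coeff_recursion:
  assumes "i < k" "j < k"
  shows "(\<Sum>t<k. power_coeff M i t v (Suc q) * M $$ (t, j))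
    = v * power_coeff M i j v (Suc q) + power_coeff M i j v (Suc (Suc q))"
proof -
  let ?F = "\<lambda>t q. coeff_ratfun M i t v (Suc q)"
  have "(\<Sum>t<k. ?F t q * A $$ (t, j))
      = (\<Sum>t<k. \<Sum>l\<in>block v. p i t l * A $$ (t, j) * ratfun_X ^ (Suc l * q))"
    by (intro sum.cong)
      (auto simp: coeff_ratfun_eq_block_sum sum_distrib_left sum_distrib_right mult_ac simp del: power_Suc)
  also have "\<dots> = (\<Sum>l\<in>block v. (\<Sum>t<k. p i t l * A $$ (t, j)) * ratfun_X ^ (Suc l * q))"
    by (subst sum.swap) (simp add: sum_distrib_right)
  also have "\<dots> = (\<Sum>l\<in>block v. ratfun_const v * (p i j l * ratfun_X ^ (Suc l * q))
      + p i j l * ratfun_X ^ (Suc l * Suc q))"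
    using p_eigen[OF assms(2)]
    by (intro sum.cong) (auto simp: block_def algebra_simps power_add)
  also have "\<dots> = ratfun_const v * ?F j q + ?F j (Suc q)"
    by (simp only: coeff_ratfun_eq_block_sum[OF assms(2)] sum.distrib sum_distrib_left)
  finally have eq: "(\<Sum>t<k. ?F t q * A $$ (t, j)) = ratfun_const v * ?F j q + ?F j (Suc q)" .
  have "(\<Sum>t<k. power_coeff M i t v (Suc q) * M $$ (t, j))
      = (\<Sum>t<k. ratfun_value (?F t q * A $$ (t, j)) 0)"
    using assms by (intro sum.cong)
      (auto simp: power_coeff_def coeff_ratfun_regular perturbed_entry_regular)
  also have "\<dots> = ratfun_value (\<Sum>t<k. ?F t q * A $$ (t, j)) 0"
    using assms by (intro ratfun_sum[THEN conjunct2, symmetric])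
      (auto simp: coeff_ratfun_regular perturbed_entry_regular)
  also have "\<dots> = v * power_coeff M i j v (Suc q) + power_coeff M i j v (Suc (Suc q))"
    unfolding eq using assms by (simp add: power_coeff_def coeff_ratfun_regular)
  finally show ?thesis .
qed

abbreviation diag_set :: "complex set" where
  "diag_set \<equiv> (\<lambda>l. M $$ (l, l)) ` {..<k}"

lemma power_coeff_sum:
  assumes "i < k" "j < k"
  shows "(\<Sum>v\<in>diag_set. power_coeff M i j v 1) = M $$ (i, j)"
proof -
  have "(\<Sum>v\<in>diag_set. power_coeff M i j v 1)
      = ratfun_value (\<Sum>v\<in>diag_set. coeff_ratfun M i j v (Suc 0)) 0"
    unfolding power_coeff_def One_nat_def using assms
    by (intro ratfun_sum[THEN conjunct2, symmetric] coeff_ratfun_regular)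
  also have "(\<Sum>v\<in>diag_set. coeff_ratfun M i j v (Suc 0)) = (\<Sum>l<k. p i j l)"
    using sum.group[of "{..<k}" "diag_set" "\<lambda>l. M $$ (l, l)" "p i j"] assms
    by (simp add: coeff_ratfun_eq_block_sum block_def)
  also have "\<dots> = A $$ (i, j)" by (rule p_sum[OF assms])
  finally show ?thesis using assms by (simp add: perturbed_entry_regular)
qed

lemma diag_mult_le: "j < k \<Longrightarrow> diag_mult M i j v \<le> k"
  unfolding diag_mult_def diag_positions_def
  by (rule order.trans[OF card_mono[of "{..<k}"]]) auto

end

section \<open>The claimed powers as a matrix recursion\<close>

definition binomial_power :: "complex \<Rightarrow> int \<Rightarrow> nat \<Rightarrow> complex" where
  "binomial_power v n q = (of_int (n - 1) gchoose q) * v powi (n - 1 - int q)"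

text \<open>
  For \<open>v = 0\<close> the exponents alone would disagree at \<open>n = q\<close>, where \<open>0 * 0 powi (- 1)\<close> meets
  \<open>0 powi 0\<close>. There \<open>n \<ge> 1\<close> is needed: it makes the binomial coefficient \<open>q - 1\<close> over \<open>q\<close>, which
  is zero.
\<close>

lemma binomial_power_shift:
  assumes "v \<noteq> 0 \<or> n \<ge> 1"
  shows "v * binomial_power v n q = (of_int (n - 1) gchoose q) * v powi (n - int q)"
proof (cases "v = 0")
  case False
  then show ?thesis by (simp add: binomial_power_def power_int_diff)
next
  case True
  consider "n - int q < 0" | "n = int q" | "n - int q > 0" by linarith
  then show ?thesis
  proof cases
    case 2
    with True assms have "n \<ge> 1" by simp
    then have "(of_int (n - 1) :: complex) = of_nat (q - 1)" and "q \<ge> 1" using 2 by auto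
    then have "(of_int (n - 1) :: complex) gchoose q = of_nat ((q - 1) choose q)"
      by (simp only: binomial_gbinomial)
    also have "(q - 1) choose q = 0" using \<open>q \<ge> 1\<close> by (simp add: binomial_eq_0)
    finally have "(of_int (n - 1) :: complex) gchoose q = 0" by simp
    then show ?thesis by (simp add: binomial_power_def)
  qed (simp_all add: True power_int_0_left_if)
qed

lemma binomial_power_0:
  assumes "v \<noteq> 0 \<or> n \<ge> 1"
  shows "binomial_power v (n + 1) 0 = v * binomial_power v n 0"
  unfolding binomial_power_shift[OF assms] by (simp add: binomial_power_def)

lemma binomial_power_Suc:
  assumes "v \<noteq> 0 \<or> n \<ge> 1"
  shows "binomial_power v (n + 1) (Suc q)
    = v * binomial_power v n (Suc q) + binomial_power v n q"
  using gbinomial_Suc_Suc[of "of_int (n - 1) :: complex" q]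
  unfolding binomial_power_shift[OF assms]
  by (simp add: binomial_power_def algebra_simps)

context triangular_matrix
begin

text \<open>
  All entries use the same diagonal values and the same range of \<open>q\<close>; the additional terms have
  coefficient zero by \<open>power_coeff_vanishes\<close>. Uniform
  ranges let the sums be interchanged with the one in the matrix product.
\<close>

definition expansion :: "int \<Rightarrow> complex mat" where
  "expansion n = mat k k (\<lambda>(i, j).
     \<Sum>v\<in>diag_set. \<Sum>q<k. power_coeff M i j v (Suc q) * binomial_power v n q)"

lemma expansion_carrier: "expansion n \<in> carrier_mat k k"
  by (simp add: expansion_def)

text \<open>
  The recursion of the coefficients moves \<open>q\<close> to \<open>q + 1\<close>; a shift of the summation index, harmless
  because the coefficient for \<open>q = k\<close> is zero, turns this into Pascal's rule.
\<close>

lemma value_sum_step: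
  assumes "v \<noteq> 0 \<or> n \<ge> 1" "i < k" "j < k"
  shows "(\<Sum>q<k. power_coeff M i j v (Suc q) * binomial_power v (n + 1) q)
    = (\<Sum>t<k. (\<Sum>q<k. power_coeff M i t v (Suc q) * binomial_power v n q) * M $$ (t, j))"
proof -
  let ?c = "\<lambda>q. power_coeff M i j v (Suc q)" and ?b = "binomial_power v n"
  obtain k' where k: "k = Suc k'" using assms(2) by (cases k) auto
  have ck: "?c k = 0"
    using assms diag_mult_le by (intro power_coeff_vanishes)
  have "(\<Sum>t<k. (\<Sum>q<k. power_coeff M i t v (Suc q) * ?b q) * M $$ (t, j))
      = (\<Sum>t<k. \<Sum>q<k. power_coeff M i t v (Suc q) * M $$ (t, j) * ?b q)"
    by (simp add: sum_distrib_left sum_distrib_right mult_ac)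
  also have "\<dots> = (\<Sum>q<k. (\<Sum>t<k. power_coeff M i t v (Suc q) * M $$ (t, j)) * ?b q)"
    by (subst sum.swap) (simp only: sum_distrib_right)
  also have "\<dots> = (\<Sum>q<k. ?c q * (v * ?b q)) + (\<Sum>q<k. ?c (Suc q) * ?b q)"
    unfolding power_coeff_recursion[OF assms(2,3)] by (simp add: algebra_simps sum.distrib)
  also have "(\<Sum>q<k. ?c (Suc q) * ?b q) = (\<Sum>q<k'. ?c (Suc q) * ?b q)"
    using ck by (simp add: k)
  also have "(\<Sum>q<k. ?c q * (v * ?b q))
      = ?c 0 * (v * ?b 0) + (\<Sum>q<k'. ?c (Suc q) * (v * ?b (Suc q)))"
    unfolding k by (rule sum.lessThan_Suc_shift)
  also have "\<dots> + (\<Sum>q<k'. ?c (Suc q) * ?b q)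
      = (\<Sum>q<k. ?c q * binomial_power v (n + 1) q)"
    unfolding k sum.lessThan_Suc_shift binomial_power_0[OF assms(1)] binomial_power_Suc[OF assms(1)]
    by (simp add: algebra_simps sum.distrib)
  finally show ?thesis by simp
qed

lemma expansion_step:
  assumes "n \<ge> 1 \<or> 0 \<notin> diag_set"
  shows "expansion (n + 1) = expansion n * M"
proof (rule eq_matI)
  fix i j assume "i < dim_row (expansion n * M)" "j < dim_col (expansion n * M)"
  then have ij: "i < k" "j < k" using M by (auto simp: expansion_def)
  have "expansion (n + 1) $$ (i, j)
      = (\<Sum>v\<in>diag_set. \<Sum>q<k. power_coeff M i j v (Suc q) * binomial_power v (n + 1) q)"
    using ij by (simp add: expansion_def)
  also have "\<dots> = (\<Sum>v\<in>diag_set. \<Sum>t<k.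
      (\<Sum>q<k. power_coeff M i t v (Suc q) * binomial_power v n q) * M $$ (t, j))"
    using assms ij by (intro sum.cong refl value_sum_step) auto
  also have "\<dots> = (\<Sum>t<k. expansion n $$ (i, t) * M $$ (t, j))"
    using ij by (subst sum.swap) (simp add: expansion_def sum_distrib_right)
  also have "\<dots> = (expansion n * M) $$ (i, j)"
    using ij M expansion_carrier[of n]
    by (auto simp: scalar_prod_def lessThan_atLeast0 intro!: sum.cong)
  finally show "expansion (n + 1) $$ (i, j) = (expansion n * M) $$ (i, j)" .
qed (use M in \<open>auto simp: expansion_def\<close>)

lemma expansion_1: "expansion 1 = M"
proof (rule eq_matI)
  fix i j assume "i < dim_row M" "j < dim_col M"
  then have ij: "i < k" "j < k" using M by auto
  obtain k' where k: "k = Suc k'" using ij by (cases k) auto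
  have "(\<Sum>q<k. power_coeff M i j v (Suc q) * binomial_power v 1 q) = power_coeff M i j v 1" for v
    unfolding k sum.lessThan_Suc_shift by (simp add: binomial_power_def)
  then show "expansion 1 $$ (i, j) = M $$ (i, j)"
    using ij power_coeff_sum[OF ij] by (simp add: expansion_def)
qed (use M in \<open>auto simp: expansion_def\<close>)

lemma expansion_pos: "expansion (int (Suc n)) = M ^\<^sub>m Suc n"
proof (induction n)
  case 0
  then show ?case using expansion_1 M by simp
next
  case (Suc n)
  then show ?case using expansion_step[of "int (Suc n)"] by (simp add: add.commute)
qed

section \<open>Powers of a triangular matrix\<close>

lemma mat_inverse_invertible:
  assumes "invertible_mat M"
  shows "M * the (mat_inverse M) = 1\<^sub>m k" "the (mat_inverse M) \<in> carrier_mat k k"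
proof -
  obtain B where B: "inverts_mat M B" "inverts_mat B M"
    using assms by (auto simp: invertible_mat_def)
  have Bk: "B \<in> carrier_mat k k"
    using B M unfolding inverts_mat_def
    by (metis carrier_matD carrier_matI index_mult_mat(2,3) index_one_mat(2,3))
  have "M \<in> Units (ring_mat TYPE(complex) k ())"
    using B M Bk by (auto simp: Units_def ring_mat_def inverts_mat_def intro!: bexI[of _ B])
  then obtain N where N: "mat_inverse M = Some N"
    using mat_inverse(1)[OF M, of "()"] by (cases "mat_inverse M") auto
  from mat_inverse(2)[OF M N] N
  show "M * the (mat_inverse M) = 1\<^sub>m k" "the (mat_inverse M) \<in> carrier_mat k k" by auto
qed

lemma invertible_diagonal_nonzero:
  assumes "invertible_mat M"
  shows "0 \<notin> diag_set"
proof -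
  note N = mat_inverse_invertible[OF assms]
  have "det M * det (the (mat_inverse M)) = 1"
    using det_mult[OF M N(2)] by (simp add: N(1))
  then have "det M \<noteq> 0" by auto
  then have "0 \<notin> set (diag_mat M)"
    using det_upper_triangular[OF triangular M] by (simp add: prod_list_zero_iff)
  then show ?thesis using M by (auto simp: diag_mat_def)
qed

lemma expansion_nonpos:
  assumes invertible: "invertible_mat M"
  shows "expansion (- int n) = the (mat_inverse M) ^\<^sub>m n"
proof -
  let ?N = "the (mat_inverse M)"
  note N = mat_inverse_invertible[OF invertible]
  \<comment> \<open>Without zero diagonal values the step also holds below \<open>n = 1\<close> and can be inverted.\<close>
  have down: "expansion m = expansion (m + 1) * ?N" for m
  proof -
    have "expansion (m + 1) * ?N = expansion m * (M * ?N)"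
      using expansion_step[of m] invertible_diagonal_nonzero[OF invertible]
        assoc_mult_mat[OF expansion_carrier M N(2)] by simp
    then show ?thesis using right_mult_one_mat[OF expansion_carrier] by (simp add: N(1))
  qed
  show ?thesis
  proof (induction n)
    case 0
    show ?case using down[of 0] N carrier_matD(1)[OF N(2)] by (simp add: expansion_1)
  next
    case (Suc n)
    then show ?case using down[of "- int (Suc n)"] by simp
  qed
qed

lemma mat_power_int_eq_expansion:
  assumes "invertible_mat M \<or> n \<ge> 1"
  shows "mat_power_int M n = expansion n"
proof (cases "n \<ge> 1")
  case True
  then have "n = int (Suc (nat n - 1))" by simp
  then show ?thesis
    using expansion_pos[of "nat n - 1"] True by (simp add: mat_power_int_def)
next
  case False
  then have "invertible_mat M" "n = - int (nat (- n))" using assms by auto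
  then show ?thesis
    using False expansion_nonpos[of "nat (- n)"] M mat_inverse_invertible(2)
    by (cases "n = 0") (auto simp: mat_power_int_def)
qed

lemma expansion_entry:
  assumes "i < k" "j < k"
  shows "expansion n $$ (i, j) = (\<Sum>v\<in>diag_values M i j. \<Sum>s = 1..diag_mult M i j v.
    power_coeff M i j v s * ((of_int (n - 1) :: complex) gchoose (s - 1)) * v powi (n - int s))"
proof -
  let ?f = "\<lambda>v q. power_coeff M i j v (Suc q) * binomial_power v n q"
  have inner: "(\<Sum>q<k. ?f v q) = (\<Sum>s = 1..diag_mult M i j v.
      power_coeff M i j v s * ((of_int (n - 1) :: complex) gchoose (s - 1)) * v powi (n - int s))"
    for v
  proof -
    have "(\<Sum>q<k. ?f v q) = (\<Sum>q<diag_mult M i j v. ?f v q)"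
      using assms diag_mult_le[OF assms(2), of i v] power_coeff_vanishes[OF assms]
      by (intro sum.mono_neutral_right) auto
    also have "\<dots> = (\<Sum>s = Suc 0..diag_mult M i j v. ?f v (s - 1))"
      by (simp add: sum.atLeast_Suc_atMost_Suc_shift sum.atLeast1_atMost_eq)
    finally show ?thesis
      by (auto intro!: sum.cong simp: binomial_power_def algebra_simps)
  qed
  have "(\<Sum>v\<in>diag_set. \<Sum>q<k. ?f v q) = (\<Sum>v\<in>diag_values M i j. \<Sum>q<k. ?f v q)"
  proof (rule sum.mono_neutral_right)
    show "diag_values M i j \<subseteq> diag_set" using assms by (auto simp: diag_values_def)
    show "\<forall>v\<in>diag_set - diag_values M i j. (\<Sum>q<k. ?f v q) = 0"
    proof
      fix v assume "v \<in> diag_set - diag_values M i j"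
      then have "v \<notin> diag_values M i j" by simp
      then have "diag_positions M i j v = {}" unfolding diag_values_def diag_positions_def by fast
      then have "diag_mult M i j v = 0" by (simp add: diag_mult_def)
      then show "(\<Sum>q<k. ?f v q) = 0" using power_coeff_vanishes[OF assms] by simp
    qed
  qed simp
  then show ?thesis using assms by (simp add: expansion_def inner)
qed

end

theorem theorem3:
  fixes M :: "complex mat" and k i j :: nat
  assumes "M \<in> carrier_mat k k"
    and "upper_triangular M"
    and "\<not> distinct (diag_mat M)"
    and "i \<le> j" and "j < k"
  shows "(\<forall>v \<in> diag_values M i j. \<forall>s \<in> {1..diag_mult M i j v}.
            \<not> ratfun_has_pole (coeff_ratfun M i j v s) 0) \<and>
         (\<forall>n::int. invertible_mat M \<or> n \<ge> 1 \<longrightarrow>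
            mat_power_int M n $$ (i, j) =
              (\<Sum>v \<in> diag_values M i j. \<Sum>s = 1..diag_mult M i j v.
                 power_coeff M i j v s * ((of_int (n - 1) :: complex) gchoose (s - 1))
                   * v powi (n - int s)))"
proof -
  interpret triangular_matrix M k by unfold_locales fact+
  have ij: "i < k" "j < k" using assms(4,5) by auto
  show ?thesis
  proof (intro conjI ballI allI impI)
    fix v s assume "s \<in> {1..diag_mult M i j v}"
    then show "\<not> ratfun_has_pole (coeff_ratfun M i j v s) 0"
      using coeff_ratfun_regular[OF ij, of v "s - 1"] by simp
  next
    fix n :: int assume "invertible_mat M \<or> n \<ge> 1"
    then show "mat_power_int M n $$ (i, j) =
        (\<Sum>v \<in> diag_values M i j. \<Sum>s = 1..diag_mult M i j v.
           power_coeff M i j v s * ((of_int (n - 1) :: complex) gchoose (s - 1))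
             * v powi (n - int s))"
      using mat_power_int_eq_expansion expansion_entry[OF ij] by simp
  qed
qed

end
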